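(* Let $(X,d)$ be a metric space. Then the following conditions are equivalent: (a) $(X,d)$ is weak $G$-complete. (b) Each real-valued continuous function on $(X,d)$ carries every $G$-Cauchy sequence of $(X,d)$ to a cofinally Cauchy sequence of $\mathbb R$ (endowed with the usual metric). (c) Each real-valued continuous function on $(X,d)$ carries every $G$-Cauchy sequence of $(X,d)$ to a pseudo-Cauchy sequence of $\mathbb R$ (endowed with the usual metric).
   Context: A sequence $(x_n)$ in a metric space $(X,d)$ is $G$-Cauchy if $\lim_{n\to\infty}d(x_n,x_{n+1})=0$. A metric space is weak $G$-complete if every $G$-Cauchy sequence in it clusters (has a cluster point). A sequence $(x_n)$ in a metric space $(Y,d)$ is cofinally Cauchy if for every $\epsilon>0$ there is an infinite subset $\mathbb N_\epsilon$ of $\mathbb N$ such that $d(x_p,x_q)<\epsilon$ for all $p,q\in\mathbb N_\epsilon$. It is pseudo-Cauchy if for every $\epsilon\in(0,1)$ and $k\in\mathbb N$ there exist $p,q\in\mathbb N$ with $p,q>k$, $p\ne q$ and $d(x_p,x_q)<\epsilon$. *)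

theory Defs
  imports "HOL-Analysis.Analysis"
begin

definition G_Cauchy :: "'a set \<Rightarrow> ('a \<Rightarrow> 'a \<Rightarrow> real) \<Rightarrow> (nat \<Rightarrow> 'a) \<Rightarrow> bool" where
  "G_Cauchy M d x \<longleftrightarrow> range x \<subseteq> M \<and> (\<lambda>n. d (x n) (x (Suc n))) \<longlonglongrightarrow> 0"

definition seq_cluster_point :: "'a topology \<Rightarrow> (nat \<Rightarrow> 'a) \<Rightarrow> 'a \<Rightarrow> bool" where
  "seq_cluster_point T x a \<longleftrightarrow>
     a \<in> topspace T \<and> (\<forall>U. openin T U \<and> a \<in> U \<longrightarrow> infinite {n. x n \<in> U})"

definition weak_G_complete :: "'a set \<Rightarrow> ('a \<Rightarrow> 'a \<Rightarrow> real) \<Rightarrow> bool" where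
  "weak_G_complete M d \<longleftrightarrow>
     (\<forall>x. G_Cauchy M d x \<longrightarrow> (\<exists>a. seq_cluster_point (Metric_space.mtopology M d) x a))"

definition cofinally_Cauchy :: "'a set \<Rightarrow> ('a \<Rightarrow> 'a \<Rightarrow> real) \<Rightarrow> (nat \<Rightarrow> 'a) \<Rightarrow> bool" where
  "cofinally_Cauchy M d x \<longleftrightarrow>
     range x \<subseteq> M \<and> (\<forall>e>0. \<exists>N. infinite N \<and> (\<forall>p\<in>N. \<forall>q\<in>N. d (x p) (x q) < e))"

(* The indices p and q are distinct; the values x p and x q may coincide. *)
definition pseudo_Cauchy :: "'a set \<Rightarrow> ('a \<Rightarrow> 'a \<Rightarrow> real) \<Rightarrow> (nat \<Rightarrow> 'a) \<Rightarrow> bool" where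
  "pseudo_Cauchy M d x \<longleftrightarrow>
     range x \<subseteq> M \<and>
     (\<forall>e\<in>{0<..<1}. \<forall>k. \<exists>p q. p > k \<and> q > k \<and> p \<noteq> q \<and> d (x p) (x q) < e)"

end

theory Submission
  imports Defs
begin

text \<open>
  If a \<open>G\<close>-Cauchy sequence clusters at \<open>a\<close>, then any continuous \<open>f\<close> sends infinitely many of its terms
  close to \<open>f a\<close>, so its image is cofinally Cauchy and hence pseudo-Cauchy. The content lies in the
  converse: a \<open>G\<close>-Cauchy sequence without cluster point must yield a continuous real function
  violating the pseudo-Cauchy condition along some \<open>G\<close>-Cauchy sequence.

  Every subset of the range of a sequence without cluster point is closed, so any function
  on that range is continuous and, by Tietze's theorem, extends to the whole space. If the sequence
  is injective, prescribing the value \<open>n\<close> at its \<open>n\<close>-th term gives images that are pairwise at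
  distance at least 1. Repeated terms would spoil this, since equal terms at different indices have
  equal images and suffice for the pseudo-Cauchy condition. An arbitrary subsequence need not be
  \<open>G\<close>-Cauchy, so repetitions are removed by loop erasure instead: each value occurs only finitely
  often, and from the last occurrence of a value one moves to the next term and jumps to the last
  occurrence of that one. Each step of the resulting injective subsequence is a step of the
  original sequence, so it stays \<open>G\<close>-Cauchy (\<open>loop_erasure\<close>).
\<close>

lemma cofinally_Cauchy_imp_pseudo_Cauchy:
  assumes "cofinally_Cauchy M d x"
  shows "pseudo_Cauchy M d x"
  unfolding pseudo_Cauchy_def
proof (intro conjI ballI allI)
  show "range x \<subseteq> M"
    using assms by (simp add: cofinally_Cauchy_def)
next
  fix e :: real and k :: nat
  assume "e \<in> {0<..<1}"
  then obtain N where N: "infinite N" "\<forall>p\<in>N. \<forall>q\<in>N. d (x p) (x q) < e"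
    using assms by (auto simp: cofinally_Cauchy_def)
  obtain p where p: "p \<in> N" "p > k"
    using N(1) by (meson infinite_nat_iff_unbounded)
  obtain q where q: "q \<in> N" "q > p"
    using N(1) by (meson infinite_nat_iff_unbounded)
  show "\<exists>p q. p > k \<and> q > k \<and> p \<noteq> q \<and> d (x p) (x q) < e"
    using p q N(2) by (intro exI[of _ p] exI[of _ q]) auto
qed

lemma cofinally_Cauchy_image_of_clustering:
  assumes f: "continuous_map T euclideanreal f"
    and a: "seq_cluster_point T x a"
  shows "cofinally_Cauchy UNIV dist (f \<circ> x)"
  unfolding cofinally_Cauchy_def
proof (intro conjI allI impI)
  fix e :: real
  assume e: "e > 0"
  define U where "U = {z \<in> topspace T. f z \<in> ball (f a) (e/2)}"
  have "openin T U"
    unfolding U_def using f by (rule openin_continuous_map_preimage) simp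
  moreover have "a \<in> U"
    using a e by (simp add: U_def seq_cluster_point_def)
  ultimately have "infinite {n. x n \<in> U}"
    using a by (simp add: seq_cluster_point_def)
  moreover have "dist ((f \<circ> x) p) ((f \<circ> x) q) < e" if "x p \<in> U" "x q \<in> U" for p q
    using that dist_triangle_half_r[of "f a" "f (x p)" e "f (x q)"]
    by (simp add: U_def)
  ultimately show "\<exists>N. infinite N \<and> (\<forall>p\<in>N. \<forall>q\<in>N. dist ((f \<circ> x) p) ((f \<circ> x) q) < e)"
    by (intro exI[of _ "{n. x n \<in> U}"]) simp
qed simp

lemma seq_cluster_point_of_subseq:
  assumes r: "strict_mono (r :: nat \<Rightarrow> nat)"
    and a: "seq_cluster_point T (x \<circ> r) a"
  shows "seq_cluster_point T x a"
  unfolding seq_cluster_point_def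
proof (intro conjI allI impI)
  show "a \<in> topspace T"
    using a by (simp add: seq_cluster_point_def)
next
  fix U
  assume "openin T U \<and> a \<in> U"
  then have "infinite {n. x (r n) \<in> U}"
    using a by (simp add: seq_cluster_point_def)
  then have "infinite (r ` {n. x (r n) \<in> U})"
    using strict_mono_imp_inj_on[OF r] by (auto simp: finite_image_iff intro: inj_on_subset)
  then show "infinite {n. x n \<in> U}"
    by (rule infinite_super[rotated]) auto
qed

lemma finitely_many_occurrences:
  assumes "range x \<subseteq> topspace T" and "\<nexists>a. seq_cluster_point T x a"
  shows "finite {m. x m = x n}"
proof (rule ccontr)
  assume inf: "infinite {m. x m = x n}"
  have "seq_cluster_point T x (x n)"
    unfolding seq_cluster_point_def
  proof (intro conjI allI impI)
    show "x n \<in> topspace T"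
      using assms(1) by auto
    show "infinite {m. x m \<in> U}" if "openin T U \<and> x n \<in> U" for U
      using that by (intro infinite_super[OF _ inf]) auto
  qed
  then show False
    using assms(2) by blast
qed

text \<open>
  Choose \<open>r (Suc k)\<close> as the last index at which the value \<open>x (Suc (r k))\<close> occurs. Then the steps of
  the subsequence are steps of \<open>x\<close>, which the pointfree equation expresses, and no value can return
  once its last occurrence has been passed.
\<close>

lemma loop_erasure:
  fixes x :: "nat \<Rightarrow> 'a"
  assumes fin: "\<And>n. finite {m. x m = x n}"
  shows "\<exists>r :: nat \<Rightarrow> nat. strict_mono r \<and> inj (x \<circ> r) \<and> x \<circ> r \<circ> Suc = x \<circ> Suc \<circ> r"
proof -
  define l where "l n = Max {m. x m = x n}" for n
  have x_l: "x (l n) = x n" for n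
    using Max_in[OF fin, of n] by (auto simp: l_def)
  have l_ge: "m \<le> l n" if "x m = x n" for m n
    unfolding l_def using that by (intro Max_ge fin) simp
  define r where "r = rec_nat (l 0) (\<lambda>_ m. l (Suc m))"
  have r_Suc: "r (Suc k) = l (Suc (r k))" for k
    by (simp add: r_def)
  have mono: "strict_mono r"
    unfolding strict_mono_Suc_iff r_Suc using l_ge[OF refl] Suc_le_lessD by blast
  have last: "m \<le> r k" if "x m = x (r k)" for m k
  proof -
    obtain n where "r k = l n"
      by (cases k) (auto simp: r_def)
    then show ?thesis
      using l_ge[of m n] that x_l by simp
  qed
  have "inj (x \<circ> r)"
  proof (rule injI)
    fix i j
    assume "(x \<circ> r) i = (x \<circ> r) j"
    then have "r i = r j"
      using last[of "r i" j] last[of "r j" i] by simp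
    then show "i = j"
      using strict_mono_eq[OF mono] by blast
  qed
  moreover have "x \<circ> r \<circ> Suc = x \<circ> Suc \<circ> r"
    by (simp add: fun_eq_iff r_Suc x_l)
  ultimately show ?thesis
    using mono by (intro exI[of _ r] conjI)
qed

text \<open>
  A point that is not a cluster point has a neighbourhood meeting the sequence at only finitely many
  indices, so the range has no accumulation point and any part of it is closed.
\<close>

lemma closedin_subset_of_range:
  assumes T: "t1_space T" and y: "range y \<subseteq> topspace T"
    and no_cluster: "\<nexists>a. seq_cluster_point T y a"
    and A: "A \<subseteq> range y"
  shows "closedin T A"
  unfolding closedin_def
proof (intro conjI)
  show "A \<subseteq> topspace T"
    using A y by blast
  show "openin T (topspace T - A)"
  proof (subst openin_subopen, intro ballI)
    fix z
    assume z: "z \<in> topspace T - A"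
    then obtain U where U: "openin T U" "z \<in> U" "finite {n. y n \<in> U}"
      using no_cluster by (auto simp: seq_cluster_point_def)
    \<comment> \<open>Only finitely many points of \<open>A\<close> lie in \<open>U\<close>, and a finite set may be removed from it.\<close>
    have "A \<inter> U \<subseteq> y ` {n. y n \<in> U}"
      using A by auto
    then have "finite (A \<inter> U)"
      using U(3) finite_surj by blast
    then have "closedin T (A \<inter> U)"
      using T A y by (auto simp: t1_space_closedin_finite)
    then have "openin T (U - A \<inter> U)"
      using U(1) by (rule openin_diff[rotated])
    moreover have "U - A \<inter> U \<subseteq> topspace T - A"
      using openin_subset[OF U(1)] by blast
    ultimately show "\<exists>V. openin T V \<and> z \<in> V \<and> V \<subseteq> topspace T - A"
      using z U(2) by blast
  qed
qed

text \<open>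
  The range is a closed discrete subspace, so the index function on it is continuous. It is unbounded,
  hence Tietze's theorem is needed for the interval \<open>UNIV\<close>.
\<close>

lemma continuous_index_function:
  assumes T: "normal_space T" "t1_space T" and y: "range y \<subseteq> topspace T" "inj y"
    and no_cluster: "\<nexists>a. seq_cluster_point T y a"
  shows "\<exists>f. continuous_map T euclideanreal f \<and> f \<circ> y = real"
proof -
  note closed = closedin_subset_of_range[OF T(2) y(1) no_cluster]
  have "continuous_map (subtopology T (range y)) euclideanreal (\<lambda>z. real (inv y z))"
    unfolding continuous_map_closedin
  proof (intro conjI ballI allI impI)
    fix C :: "real set"
    have "closedin T {z \<in> topspace (subtopology T (range y)). real (inv y z) \<in> C}"
      by (rule closed) auto
    then show "closedin (subtopology T (range y))
        {z \<in> topspace (subtopology T (range y)). real (inv y z) \<in> C}"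
      by (rule closedin_subset_topspace) auto
  qed simp
  then obtain f where f: "continuous_map T euclideanreal f"
    "\<And>z. z \<in> range y \<Longrightarrow> f z = real (inv y z)"
    using Tietze_extension_realinterval[OF T(1) closed[OF subset_refl], of UNIV] by auto
  have "f \<circ> y = real"
    using f(2) y(2) by (simp add: fun_eq_iff)
  with f(1) show ?thesis
    by (intro exI[of _ f] conjI)
qed

lemma not_pseudo_Cauchy_real: "\<not> pseudo_Cauchy UNIV dist real"
proof
  assume "pseudo_Cauchy UNIV dist real"
  then have "\<forall>e\<in>{0<..<1}. \<exists>p q. p \<noteq> q \<and> dist (real p) (real q) < e"
    unfolding pseudo_Cauchy_def by blast
  from this[THEN bspec, of "1/2"]
  obtain p q where "p \<noteq> q" "\<bar>real p - real q\<bar> < 1/2"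
    by (auto simp: dist_real_def)
  then show False
    by linarith
qed

lemma non_pseudo_Cauchy_image_of_non_clustering:
  assumes "Metric_space X d" and x: "G_Cauchy X d x"
    and no_cluster: "\<nexists>a. seq_cluster_point (Metric_space.mtopology X d) x a"
  shows "\<exists>f y. continuous_map (Metric_space.mtopology X d) euclideanreal f \<and>
    G_Cauchy X d y \<and> \<not> pseudo_Cauchy UNIV dist (f \<circ> y)"
proof -
  interpret Metric_space X d
    by fact
  have range_x: "range x \<subseteq> X"
    using x by (simp add: G_Cauchy_def)
  have fin: "finite {m. x m = x n}" for n
    using range_x by (intro finitely_many_occurrences[OF _ no_cluster]) simp
  from loop_erasure[OF fin] obtain r :: "nat \<Rightarrow> nat"
    where r: "strict_mono r" "inj (x \<circ> r)" "x \<circ> r \<circ> Suc = x \<circ> Suc \<circ> r"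
    by (elim exE conjE)
  have "((\<lambda>n. d (x n) (x (Suc n))) \<circ> r) \<longlonglongrightarrow> 0"
    using x r(1) unfolding G_Cauchy_def by (blast intro: LIMSEQ_subseq_LIMSEQ)
  moreover have "(\<lambda>n. d (x n) (x (Suc n))) \<circ> r = (\<lambda>n. d ((x \<circ> r) n) ((x \<circ> r) (Suc n)))"
    using fun_cong[OF r(3)] by (intro ext) simp
  moreover have "range (x \<circ> r) \<subseteq> X"
    using range_x by auto
  ultimately have G: "G_Cauchy X d (x \<circ> r)"
    by (simp only: G_Cauchy_def)
  have no_cluster_r: "\<nexists>a. seq_cluster_point mtopology (x \<circ> r) a"
    using no_cluster seq_cluster_point_of_subseq[OF r(1), of mtopology x] by blast
  have range_r: "range (x \<circ> r) \<subseteq> topspace mtopology"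
    using range_x by auto
  from continuous_index_function[OF normal_space_mtopology t1_space_mtopology
      range_r r(2) no_cluster_r]
  obtain f where f: "continuous_map mtopology euclideanreal f" "f \<circ> (x \<circ> r) = real"
    by (elim exE conjE)
  have "\<not> pseudo_Cauchy UNIV dist (f \<circ> (x \<circ> r))"
    unfolding f(2) by (rule not_pseudo_Cauchy_real)
  with f(1) G show ?thesis
    by (intro exI[of _ f] exI[of _ "x \<circ> r"] conjI)
qed

theorem corollary3p1:
  fixes X :: "'a set" and d :: "'a \<Rightarrow> 'a \<Rightarrow> real"
  assumes "Metric_space X d"
  shows
    "(weak_G_complete X d \<longleftrightarrow>
        (\<forall>f. continuous_map (Metric_space.mtopology X d) euclideanreal f \<longrightarrow>
          (\<forall>x. G_Cauchy X d x \<longrightarrow> cofinally_Cauchy (UNIV :: real set) dist (f \<circ> x)))) \<and>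
     (weak_G_complete X d \<longleftrightarrow>
        (\<forall>f. continuous_map (Metric_space.mtopology X d) euclideanreal f \<longrightarrow>
          (\<forall>x. G_Cauchy X d x \<longrightarrow> pseudo_Cauchy (UNIV :: real set) dist (f \<circ> x))))"
    (is "(?a \<longleftrightarrow> ?b) \<and> (?a \<longleftrightarrow> ?c)")
proof -
  have "?b" if a: "?a"
  proof (intro allI impI)
    fix f x
    assume f: "continuous_map (Metric_space.mtopology X d) euclideanreal f"
      and "G_Cauchy X d x"
    then obtain z where "seq_cluster_point (Metric_space.mtopology X d) x z"
      using a by (auto simp: weak_G_complete_def)
    then show "cofinally_Cauchy UNIV dist (f \<circ> x)"
      by (rule cofinally_Cauchy_image_of_clustering[OF f])
  qed
  moreover have "?c" if b: "?b"
    by (intro allI impI cofinally_Cauchy_imp_pseudo_Cauchy b[rule_format])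
  moreover have "?a" if c: "?c"
    unfolding weak_G_complete_def
  proof (intro allI impI, rule ccontr)
    fix x
    assume "G_Cauchy X d x" "\<nexists>a. seq_cluster_point (Metric_space.mtopology X d) x a"
    from non_pseudo_Cauchy_image_of_non_clustering[OF assms this]
    show False
      using c by blast
  qed
  ultimately show ?thesis
    by argo
qed

end
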